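(* If $L$ is a finite-dimensional $\omega$-Lie algebra over $K$ with nondegenerate $\omega$, then $\dim L = 2$.
   Context: $K$ is a field of characteristic different from $2$ and $3$. An $\omega$-Lie algebra is an anticommutative algebra $L$ over $K$ with multiplication $[\cdot,\cdot]$ for which there is a bilinear form $\omega: L\times L\to K$ (necessarily skew-symmetric) such that for all $x,y,z\in L$ $$[[x,y],z]+[[z,x],y]+[[y,z],x] = \omega(x,y)z+\omega(z,x)y+\omega(y,z)x .$$ The form $\omega$ is nondegenerate if its kernel $\{x\in L \mid \omega(x,L)=0\}$ is zero.
   Formalization: The algebra L is assumed to be nonzero: the zero algebra is a finite-dimensional ω-Lie algebra whose form has zero kernel, but it has dimension 0, so the statement as written fails for it and only for it. *)

theory Defs
  imports "HOL-Computational_Algebra.Computational_Algebra"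
begin

text \<open>
  A vector space over a field is given by the library locale \<^locale>\<open>vector_space\<close>: its
  underlying set is a whole type of class \<^class>\<open>ab_group_add\<close> and the scalar
  multiplication \<open>scale\<close> is explicit.
\<close>

definition finite_dimensional ::
    "('k::field \<Rightarrow> 'v::ab_group_add \<Rightarrow> 'v) \<Rightarrow> bool" where
  "finite_dimensional scale \<longleftrightarrow>
     vector_space scale \<and> (\<exists>B. finite B \<and> module.span scale B = UNIV)"

definition bilinear_map ::
    "('k::field \<Rightarrow> 'u::ab_group_add \<Rightarrow> 'u) \<Rightarrow> ('k \<Rightarrow> 'v::ab_group_add \<Rightarrow> 'v) \<Rightarrow>
     ('k \<Rightarrow> 'w::ab_group_add \<Rightarrow> 'w) \<Rightarrow> ('u \<Rightarrow> 'v \<Rightarrow> 'w) \<Rightarrow> bool" where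
  "bilinear_map s1 s2 s3 f \<longleftrightarrow>
     (\<forall>x. Vector_Spaces.linear s2 s3 (\<lambda>y. f x y)) \<and>
     (\<forall>y. Vector_Spaces.linear s1 s3 (\<lambda>x. f x y))"

text \<open>
  No skew-symmetry of \<open>\<omega>\<close> is required: it follows from the identity below when the
  characteristic is not 2 or 3.
\<close>

locale omega_Lie_algebra = vector_space scale
  for scale :: "'k::field \<Rightarrow> 'v::ab_group_add \<Rightarrow> 'v" +
  fixes bracket :: "'v \<Rightarrow> 'v \<Rightarrow> 'v"
    and \<omega> :: "'v \<Rightarrow> 'v \<Rightarrow> 'k"
  assumes bilinear_bracket: "bilinear_map scale scale scale bracket"
    and anticommutative: "bracket x y = - bracket y x"
    and bilinear_form: "bilinear_map scale scale (*) \<omega>"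
    and omega_Jacobi:
      "bracket (bracket x y) z + bracket (bracket z x) y + bracket (bracket y z) x
       = scale (\<omega> x y) z + scale (\<omega> z x) y + scale (\<omega> y z) x"

definition form_kernel :: "('v \<Rightarrow> 'v \<Rightarrow> 'k::field) \<Rightarrow> 'v set" where
  "form_kernel \<omega> = {x. \<forall>y. \<omega> x y = 0}"

definition nondegenerate :: "('v::ab_group_add \<Rightarrow> 'v \<Rightarrow> 'k::field) \<Rightarrow> bool" where
  "nondegenerate \<omega> \<longleftrightarrow> form_kernel \<omega> = {0}"

end

theory Submission
  imports Defs
begin

text \<open>
  Write \<open>n\<close> for the dimension and \<open>d\<omega>(x, y, z) = \<omega>([x, y], z) + \<omega>([z, x], y) + \<omega>([y, z], x)\<close>.
  In every anticommutative algebra, \<open>[J(x, y, z), w]\<close> and \<open>J([x, y], z, w)\<close>, summed with signs over the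
  shuffles of the four arguments, give the same element, where \<open>J\<close> is the Jacobian. Here \<open>J = \<omega> \<and> id\<close>, and the
  equality becomes \<open>\<omega> \<and> [\<cdot>, \<cdot>] = d\<omega> \<and> id\<close> (\<open>degree_4_identity\<close>). Pairing it with a fifth
  vector and alternating again gives \<open>\<omega> \<and> d\<omega> = 0\<close> (\<open>degree_5_identity\<close>).

  Nondegeneracy enters through systems of mutually orthogonal hyperbolic pairs
  \<open>(p\<^sub>i, q\<^sub>i)\<close>, of which \<open>k\<close> exist as soon as \<open>2k < n + 2\<close> (\<open>hyperbolic_system_exists\<close>). Two
  different arguments exclude \<open>n > 2\<close>.

  \<^item> If \<open>n \<ge> 7\<close>, there are four pairs. Exterior multiplication by \<open>\<omega>\<close> is then injective on forms
    of degree 2 and 3, as far as it can be tested on the pairs. So the second identity makes \<open>d\<omega>\<close>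
    vanish there, and the first one makes the brackets of \<open>p\<^sub>0\<close>, \<open>q\<^sub>0\<close>, \<open>p\<^sub>1\<close> vanish.
    But \<open>J(p\<^sub>0, q\<^sub>0, p\<^sub>1) = p\<^sub>1\<close> (\<open>no_four_hyperbolic_pairs\<close>).

  \<^item> If \<open>3 \<le> n \<le> 6\<close>, the trace of the Jacobi identity reads
    \<open>tr ad [x, y] = (n - 2) \<omega>(x, y)\<close>, and \<open>n - 2\<close>, being one of 1, 2, 3, 4, is invertible in the field.
    So \<open>\<omega>(x, y) = g [x, y]\<close> for the linear form \<open>g = tr ad / (n - 2)\<close>, whence \<open>d\<omega> = \<omega> \<and> g\<close>.
    Applying \<open>g\<close> to the first identity gives \<open>\<omega> \<and> \<omega> = \<omega> \<and> g \<and> g = 0\<close>, which fails on two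
    hyperbolic pairs (\<open>no_primitive_of_form\<close>).

  The trace argument needs \<open>n - 2\<close> to be nonzero in the field, which in positive characteristic is
  not automatic for large \<open>n\<close>; this is why the large dimensions are treated separately.
\<close>

section \<open>The trace of a linear endomorphism\<close>

context finite_dimensional_vector_space
begin

definition trace :: "('b \<Rightarrow> 'b) \<Rightarrow> 'a" where
  "trace f = (\<Sum>b\<in>Basis. representation Basis (f b) b)"

lemma trace_add: "trace (\<lambda>v. f v + g v) = trace f + trace g"
  by (simp add: trace_def independent_Basis span_Basis representation_add sum.distrib)

lemma trace_diff: "trace (\<lambda>v. f v - g v) = trace f - trace g"
  by (simp add: trace_def independent_Basis span_Basis representation_diff sum_subtractf)

lemma trace_scale: "trace (\<lambda>v. scale c (f v)) = c * trace f"
  by (simp add: trace_def independent_Basis span_Basis representation_scale sum_distrib_left)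

lemma trace_id: "trace (\<lambda>v. v) = of_nat (card Basis)"
  by (simp add: trace_def independent_Basis span_Basis representation_basis)

lemma linear_expansion:
  fixes s :: "'a \<Rightarrow> 'c::ab_group_add \<Rightarrow> 'c"
  assumes "Vector_Spaces.linear scale s f"
  shows "f v = (\<Sum>b\<in>Basis. s (representation Basis v b) (f b))"
proof -
  interpret f: Vector_Spaces.linear scale s f by fact
  have "v = (\<Sum>b\<in>Basis. scale (representation Basis v b) b)"
    by (simp add: independent_Basis span_Basis finite_Basis sum_representation_eq)
  then have "f v = f (\<Sum>b\<in>Basis. scale (representation Basis v b) b)"
    by (rule arg_cong)
  then show ?thesis
    by (simp add: f.sum f.scale)
qed

lemma trace_rank_one:
  assumes "Vector_Spaces.linear scale (*) \<phi>"
  shows "trace (\<lambda>v. scale (\<phi> v) y) = \<phi> y"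
  using linear_expansion[OF assms, of y]
  by (simp add: trace_def independent_Basis span_Basis representation_scale mult.commute)

lemma trace_commute:
  assumes f: "Vector_Spaces.linear scale scale f" and g: "Vector_Spaces.linear scale scale g"
  shows "trace (\<lambda>v. f (g v)) = trace (\<lambda>v. g (f v))"
proof -
  have coord: "representation Basis (h v) c
      = (\<Sum>b\<in>Basis. representation Basis v b * representation Basis (h b) c)"
    if h: "Vector_Spaces.linear scale scale h" for h v c
    by (subst linear_expansion[OF h, of v])
       (simp add: independent_Basis span_Basis representation_sum representation_scale)
  show ?thesis
    unfolding trace_def
    by (simp add: coord[OF f, of "g _"] coord[OF g, of "f _"])
       (subst sum.swap, simp add: mult.commute)
qed

end

section \<open>Identities for the form\<close>

context omega_Lie_algebra
begin

lemma linear_bracket_right: "Vector_Spaces.linear scale scale (bracket x)"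
  and linear_bracket_left: "Vector_Spaces.linear scale scale (\<lambda>x. bracket x y)"
  using bilinear_bracket by (auto simp: bilinear_map_def)

lemma linear_form_right: "Vector_Spaces.linear scale (*) (\<omega> x)"
  and linear_form_left: "Vector_Spaces.linear scale (*) (\<lambda>x. \<omega> x y)"
  using bilinear_form by (auto simp: bilinear_map_def)

lemma bracket_scale_right: "bracket x (scale c y) = scale c (bracket x y)"
  using linear_bracket_right[of x] by (simp add: Vector_Spaces.linear_iff)

lemma bracket_add_left: "bracket (x + y) z = bracket x z + bracket y z"
  and bracket_scale_left: "bracket (scale c x) z = scale c (bracket x z)"
  using linear_bracket_left[of z] by (simp_all add: Vector_Spaces.linear_iff)

lemma form_add_right: "\<omega> x (y + z) = \<omega> x y + \<omega> x z"
  and form_scale_right: "\<omega> x (scale c y) = c * \<omega> x y"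
  using linear_form_right[of x] by (simp_all add: Vector_Spaces.linear_iff)

lemma form_add_left: "\<omega> (x + y) z = \<omega> x z + \<omega> y z"
  and form_scale_left: "\<omega> (scale c x) z = c * \<omega> x z"
  using linear_form_left[of z] by (simp_all add: Vector_Spaces.linear_iff)

lemma bracket_minus_right: "bracket x (- y) = - bracket x y"
  using bracket_scale_right[of x "-1" y] by simp

lemma bracket_minus_left: "bracket (- x) y = - bracket x y"
  using bracket_scale_left[of "-1" x y] by simp

lemma form_minus_right: "\<omega> x (- y) = - \<omega> x y"
  using form_scale_right[of x "-1" y] by simp

lemma form_minus_left: "\<omega> (- x) y = - \<omega> x y"
  using form_scale_left[of "-1" x y] by simp

lemma form_zero_right [simp]: "\<omega> x 0 = 0"
  using form_scale_right[of x 0 0] by simp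

lemma form_zero_left [simp]: "\<omega> 0 x = 0"
  using form_scale_left[of 0 0 x] by simp

lemma form_diff_right: "\<omega> x (y - z) = \<omega> x y - \<omega> x z"
  using form_add_right[of x y "- z"] by (simp add: form_minus_right)

lemma form_diff_left: "\<omega> (x - y) z = \<omega> x z - \<omega> y z"
  using form_add_left[of x "- y" z] by (simp add: form_minus_left)

lemma form_sum_left: "\<omega> (sum f A) y = (\<Sum>i\<in>A. \<omega> (f i) y)"
  by (induction A rule: infinite_finite_induct) (simp_all add: form_add_left)

definition d\<omega> :: "'v \<Rightarrow> 'v \<Rightarrow> 'v \<Rightarrow> 'k" where
  "d\<omega> x y z = \<omega> (bracket x y) z + \<omega> (bracket z x) y + \<omega> (bracket y z) x"

lemma d\<omega>_rotate: "d\<omega> x y z = d\<omega> y z x"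
  by (simp add: d\<omega>_def algebra_simps)

end

locale nondegenerate_omega_Lie_algebra = omega_Lie_algebra scale bracket \<omega>
  for scale :: "'k::field \<Rightarrow> 'v::ab_group_add \<Rightarrow> 'v" and bracket \<omega> +
  assumes two_neq_0: "(2::'k) \<noteq> 0"
    and three_neq_0: "(3::'k) \<noteq> 0"
    and nondegenerate: "nondegenerate \<omega>"
begin

lemma double_eq_0_iff: "v + v = 0 \<longleftrightarrow> v = (0::'v)"
proof -
  have "v + v = scale 2 v"
    by (metis one_add_one scale_left_distrib scale_one)
  then show ?thesis
    using two_neq_0 by simp
qed

lemma bracket_self: "bracket x x = 0"
  using anticommutative[of x x] double_eq_0_iff[of "bracket x x"]
  by (metis add.right_inverse)

text \<open>
  With three equal arguments the left-hand side of the Jacobi identity vanishes, and the right-hand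
  side is \<open>3 \<omega>(x, x) x\<close>.
\<close>

lemma form_self: "\<omega> x x = 0"
proof -
  have "scale (\<omega> x x) x + scale (\<omega> x x) x + scale (\<omega> x x) x = 0"
    using omega_Jacobi[of x x x] bracket_self[of x] bracket_scale_left[of 0 0 x] by simp
  then have "scale (3 * \<omega> x x) x = 0"
    by (simp add: scale_left_distrib[symmetric])
  then show ?thesis
    using three_neq_0 by auto
qed

lemma form_skew: "\<omega> x y = - \<omega> y x"
proof -
  have "\<omega> x y + \<omega> y x = 0"
    using form_self[of "x + y"] form_self[of x] form_self[of y]
    by (simp add: form_add_left form_add_right add.commute)
  then show ?thesis
    by (simp add: eq_neg_iff_add_eq_0)
qed

text \<open>
  The two identities that follow say that \<open>\<omega> \<and> [\<cdot>, \<cdot>] = d\<omega> \<and> id\<close> and that \<open>\<omega> \<and> d\<omega> = 0\<close>, in the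
  normalisation of the exterior product that sums over shuffles and so involves no denominators.
  The first compares the bracket of a Jacobian with a vector (\<open>J\<close> in the proof) with the Jacobian of
  a bracket and two vectors (\<open>K\<close>). Alternated over four vectors, both left-hand sides consist
  of the twelve products \<open>[[[a, b], c], d]\<close>; the products \<open>[[a, b], [c, d]]\<close> cancel in pairs. On the
  right, \<open>J\<close> contributes \<open>\<omega> \<and> [\<cdot>, \<cdot>]\<close> twice, while \<open>K\<close> contributes it once, together with \<open>d\<omega> \<and> id\<close>.
\<close>

lemma degree_4_identity:
  "scale (\<omega> x y) (bracket z w) + scale (\<omega> z w) (bracket x y)
    - scale (\<omega> x z) (bracket y w) - scale (\<omega> y w) (bracket x z)
    + scale (\<omega> x w) (bracket y z) + scale (\<omega> y z) (bracket x w)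
   = scale (d\<omega> x y z) w - scale (d\<omega> x y w) z + scale (d\<omega> x z w) y - scale (d\<omega> y z w) x"
proof -
  define Jl where "Jl a b c d = bracket (bracket (bracket a b) c) d
    + bracket (bracket (bracket c a) b) d + bracket (bracket (bracket b c) a) d" for a b c d
  define Jr where "Jr a b c d = scale (\<omega> a b) (bracket c d) + scale (\<omega> c a) (bracket b d)
    + scale (\<omega> b c) (bracket a d)" for a b c d
  define Kl where "Kl a b c d = bracket (bracket (bracket a b) c) d
    - bracket (bracket (bracket a b) d) c - bracket (bracket a b) (bracket c d)" for a b c d
  define Kr where "Kr a b c d = scale (\<omega> (bracket a b) c) d - scale (\<omega> (bracket a b) d) c
    + scale (\<omega> c d) (bracket a b)" for a b c d
  have J: "Jl a b c d = Jr a b c d" for a b c d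
    using arg_cong[OF omega_Jacobi[of a b c], of "\<lambda>v. bracket v d"]
    by (simp add: bracket_add_left bracket_scale_left Jl_def Jr_def)
  have K: "Kl a b c d = Kr a b c d" for a b c d
    using omega_Jacobi[of "bracket a b" c d] anticommutative[of d "bracket a b"]
      anticommutative[of "bracket c d" "bracket a b"] form_skew[of d "bracket a b"]
    by (simp add: bracket_minus_left Kl_def Kr_def)
  note lin = bracket_minus_left bracket_minus_right form_minus_left form_minus_right
    scale_minus_left scale_minus_right scale_left_distrib scale_left_diff_distrib
  note orient = anticommutative[of y x] anticommutative[of z x] anticommutative[of w x]
    anticommutative[of z y] anticommutative[of w y] anticommutative[of w z]
    form_skew[of y x] form_skew[of z x] form_skew[of w x]
    form_skew[of z y] form_skew[of w y] form_skew[of w z]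
    anticommutative[of "bracket x y" "bracket z w"]
    anticommutative[of "bracket x z" "bracket y w"]
    anticommutative[of "bracket x w" "bracket y z"]
  have "Jl x y z w - Jl x y w z + Jl x z w y - Jl y z w x
      = Kl x y z w + Kl z w x y - Kl x z y w - Kl y w x z + Kl x w y z + Kl y z x w"
    unfolding Jl_def Kl_def orient lin by (simp add: algebra_simps)
  then have "Jr x y z w - Jr x y w z + Jr x z w y - Jr y z w x
      = Kr x y z w + Kr z w x y - Kr x z y w - Kr y w x z + Kr x w y z + Kr y z x w"
    unfolding J K .
  then show ?thesis
    unfolding Jr_def Kr_def d\<omega>_def orient lin by (simp add: algebra_simps)
qed

text \<open>
  Apply \<open>\<omega>(\<cdot>, t)\<close> to the previous identity and alternate over the five vectors. On the left each product
  \<open>\<omega> \<cdot> d\<omega>\<close> arises once, since its three summands in \<open>d\<omega>\<close> come from three choices of \<open>t\<close>. On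
  the right it arises twice, since either argument of \<open>\<omega>\<close> can be \<open>t\<close>. So the sum equals its own
  double.
\<close>

lemma degree_5_identity:
  "\<omega> x y * d\<omega> z u v - \<omega> x z * d\<omega> y u v + \<omega> x u * d\<omega> y z v - \<omega> x v * d\<omega> y z u
    + \<omega> y z * d\<omega> x u v - \<omega> y u * d\<omega> x z v + \<omega> y v * d\<omega> x z u
    + \<omega> z u * d\<omega> x y v - \<omega> z v * d\<omega> x y u + \<omega> u v * d\<omega> x y z = 0"
  (is "?S = 0")
proof -
  have D: "\<omega> a b * \<omega> (bracket c d) t + \<omega> c d * \<omega> (bracket a b) t
    - \<omega> a c * \<omega> (bracket b d) t - \<omega> b d * \<omega> (bracket a c) t
    + \<omega> a d * \<omega> (bracket b c) t + \<omega> b c * \<omega> (bracket a d) t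
   = d\<omega> a b c * \<omega> d t - d\<omega> a b d * \<omega> c t + d\<omega> a c d * \<omega> b t - d\<omega> b c d * \<omega> a t"
    (is "?l a b c d t = ?r a b c d t") for a b c d t
    using arg_cong[OF degree_4_identity[of a b c d], of "\<lambda>w. \<omega> w t"]
    by (simp add: form_add_left form_diff_left form_scale_left)
  have skew: "\<omega> v u = - \<omega> u v" "\<omega> v z = - \<omega> z v" "\<omega> u z = - \<omega> z u" "\<omega> v y = - \<omega> y v"
    "\<omega> u y = - \<omega> y u" "\<omega> z y = - \<omega> y z" "\<omega> v x = - \<omega> x v" "\<omega> u x = - \<omega> x u"
    "\<omega> z x = - \<omega> x z" "\<omega> y x = - \<omega> x y"
    by (rule form_skew)+
  have d: "d\<omega> a b c = \<omega> (bracket a b) c - \<omega> (bracket a c) b + \<omega> (bracket b c) a" for a b c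
    using anticommutative[of c a] by (simp add: d\<omega>_def form_minus_left)
  have "?S = ?l x y z u v - ?l x y z v u + ?l x y u v z - ?l x z u v y + ?l y z u v x"
    by (simp add: d algebra_simps)
  also have "\<dots> = ?r x y z u v - ?r x y z v u + ?r x y u v z - ?r x z u v y + ?r y z u v x"
    by (simp only: D)
  also have "\<dots> = 2 * ?S"
    unfolding skew by (simp add: algebra_simps)
  finally show ?thesis
    by (metis mult_2 add_cancel_right_right)
qed

section \<open>Hyperbolic systems\<close>

definition hyperbolic_system :: "(nat \<Rightarrow> 'v) \<Rightarrow> (nat \<Rightarrow> 'v) \<Rightarrow> nat \<Rightarrow> bool" where
  "hyperbolic_system p q k \<longleftrightarrow> (\<forall>i<k. \<forall>j<k.
     \<omega> (p i) (p j) = 0 \<and> \<omega> (q i) (q j) = 0 \<and> \<omega> (p i) (q j) = (if i = j then 1 else 0))"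

lemma hyperbolic_systemD:
  assumes "hyperbolic_system p q k" "i < k" "j < k"
  shows "\<omega> (p i) (p j) = 0" "\<omega> (q i) (q j) = 0"
    "\<omega> (p i) (q j) = (if i = j then 1 else 0)" "\<omega> (q i) (p j) = (if i = j then - 1 else 0)"
  using assms form_skew[of "q i" "p j"] by (auto simp: hyperbolic_system_def)

text \<open>
  The vector \<open>w\<close> is the orthogonal projection of \<open>v\<close> onto the span of the system.
\<close>

lemma orthogonal_translate_exists:
  assumes hyp: "hyperbolic_system p q k"
  obtains w where "w \<in> span (p ` {..<k} \<union> q ` {..<k})"
    and "\<And>j. j < k \<Longrightarrow> \<omega> (v - w) (p j) = 0" and "\<And>j. j < k \<Longrightarrow> \<omega> (v - w) (q j) = 0"
proof
  let ?w = "\<Sum>i<k. scale (\<omega> v (q i)) (p i) - scale (\<omega> v (p i)) (q i)"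
  show "?w \<in> span (p ` {..<k} \<union> q ` {..<k})"
    by (intro span_sum span_diff span_scale) (auto intro: span_base)
  note expand = form_diff_left form_sum_left form_scale_left
  show "\<omega> (v - ?w) (p j) = 0" if "j < k" for j
  proof -
    have "(\<Sum>i<k. \<omega> v (q i) * \<omega> (p i) (p j) - \<omega> v (p i) * \<omega> (q i) (p j))
        = (\<Sum>i<k. if i = j then \<omega> v (p i) else 0)"
      by (rule sum.cong) (use that in \<open>auto simp: hyperbolic_systemD[OF hyp]\<close>)
    then show ?thesis
      using that by (simp add: expand)
  qed
  show "\<omega> (v - ?w) (q j) = 0" if "j < k" for j
  proof -
    have "(\<Sum>i<k. \<omega> v (q i) * \<omega> (p i) (q j) - \<omega> v (p i) * \<omega> (q i) (q j))
        = (\<Sum>i<k. if i = j then \<omega> v (q i) else 0)"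
      by (rule sum.cong) (use that in \<open>auto simp: hyperbolic_systemD[OF hyp]\<close>)
    then show ?thesis
      using that by (simp add: expand)
  qed
qed

lemma form_eq_0_on_span:
  assumes "w \<in> span S" and "\<And>s. s \<in> S \<Longrightarrow> \<omega> z s = 0"
  shows "\<omega> z w = 0"
  using assms(1)
  by (induction rule: span_induct_alt) (simp_all add: form_add_right form_scale_right assms(2))

text \<open>
  A vector outside the span of the system has a nonzero component \<open>a\<close> orthogonal to it. A partner
  of \<open>a\<close> exists by nondegeneracy, and removing its projection onto the span does not
  change its pairing with \<open>a\<close>.
\<close>

lemma hyperbolic_system_extend:
  assumes hyp: "hyperbolic_system p q k" and dim: "2 * k < dim (UNIV :: 'v set)"
  shows "\<exists>p' q'. hyperbolic_system p' q' (Suc k)"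
proof -
  let ?S = "p ` {..<k} \<union> q ` {..<k}"
  have "card ?S \<le> card (p ` {..<k}) + card (q ` {..<k})"
    by (rule card_Un_le)
  also have "\<dots> \<le> 2 * k"
    using card_image_le[of "{..<k}" p] card_image_le[of "{..<k}" q] by simp
  finally have "\<not> UNIV \<subseteq> span ?S"
    using dim dim_le_card[of UNIV ?S] by auto
  then obtain v where v: "v \<notin> span ?S"
    by auto
  obtain w where w: "w \<in> span ?S" "\<And>j. j < k \<Longrightarrow> \<omega> (v - w) (p j) = 0" "\<And>j. j < k \<Longrightarrow> \<omega> (v - w) (q j) = 0"
    using orthogonal_translate_exists[OF hyp, of v] by blast
  define a where "a = v - w"
  have a: "\<omega> a s = 0" if "s \<in> ?S" for s
    using that w by (auto simp: a_def)
  have "a \<noteq> 0"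
    using v w(1) by (auto simp: a_def)
  then obtain b0 where b0: "\<omega> a b0 \<noteq> 0"
    using nondegenerate by (auto simp: nondegenerate_def form_kernel_def)
  obtain w' where w': "w' \<in> span ?S" "\<And>j. j < k \<Longrightarrow> \<omega> (b0 - w') (p j) = 0"
    "\<And>j. j < k \<Longrightarrow> \<omega> (b0 - w') (q j) = 0"
    using orthogonal_translate_exists[OF hyp, of b0] by blast
  define b where "b = scale (inverse (\<omega> a b0)) (b0 - w')"
  have "\<omega> a w' = 0"
    using w'(1) a by (rule form_eq_0_on_span)
  then have ab: "\<omega> a b = 1"
    using b0 by (simp add: b_def form_scale_right form_diff_right)
  have b: "\<omega> b s = 0" if "s \<in> ?S" for s
    using that w' by (auto simp: b_def form_scale_left)
  have a': "\<omega> s a = 0" and b': "\<omega> s b = 0" if "s \<in> ?S" for s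
    using form_skew[of s a] form_skew[of s b] a[OF that] b[OF that] by simp_all
  have "hyperbolic_system (p(k := a)) (q(k := b)) (Suc k)"
    using hyp a b a' b' ab
    by (auto simp: hyperbolic_system_def less_Suc_eq form_self)
  then show ?thesis
    by blast
qed

lemma hyperbolic_system_exists:
  assumes "2 * k < dim (UNIV :: 'v set) + 2"
  shows "\<exists>p q. hyperbolic_system p q k"
  using assms
proof (induction k)
  case 0
  then show ?case
    by (simp add: hyperbolic_system_def)
next
  case (Suc k)
  then obtain p q where "hyperbolic_system p q k"
    by auto
  then show ?case
    using Suc.prems by (intro hyperbolic_system_extend) auto
qed

section \<open>Excluding the large dimensions\<close>

text \<open>
  These two lemmas evaluate \<open>\<omega> \<and> d\<omega> = 0\<close> on vectors among which few pairings are nonzero, so that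
  one or two terms survive.
\<close>

lemma d\<omega>_isotropic:
  assumes "\<omega> x y = 0" "\<omega> x z = 0" "\<omega> y z = 0"
    and "\<omega> x u = 0" "\<omega> y u = 0" "\<omega> z u = 0" "\<omega> x v = 0" "\<omega> y v = 0" "\<omega> z v = 0" "\<omega> u v = 1"
  shows "d\<omega> x y z = 0"
  using degree_5_identity[of x y z u v] assms by simp

lemma d\<omega>_two_pairs:
  assumes "\<omega> a a' = 1" "\<omega> b b' = 1"
    and "\<omega> a b = 0" "\<omega> a b' = 0" "\<omega> a' b = 0" "\<omega> a' b' = 0"
    and "\<omega> a z = 0" "\<omega> a' z = 0" "\<omega> b z = 0" "\<omega> b' z = 0"
  shows "d\<omega> a a' z + d\<omega> b b' z = 0"
  using degree_5_identity[of a a' b b' z] assms by (simp add: add.commute)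

text \<open>
  Four pairs are what the vanishing of \<open>d\<omega>\<close> requires: three isotropic basis vectors of different pairs
  leave a fourth pair for \<open>d\<omega>_isotropic\<close>, and a vector of one pair leaves three others, on
  which \<open>d\<omega>(p\<^sub>i, q\<^sub>i, z)\<close> takes values any two of which are opposite.
\<close>

lemma no_four_hyperbolic_pairs: "\<not> hyperbolic_system p q 4"
proof
  assume hyp: "hyperbolic_system p q 4"
  note h = hyperbolic_systemD[OF hyp]
  have pair: "d\<omega> (p i) (q i) z = 0"
    if ijk: "i < 4" "j < 4" "k < 4" "i \<noteq> j" "j \<noteq> k" "i \<noteq> k"
      and z: "\<And>l. l \<in> {i, j, k} \<Longrightarrow> \<omega> (p l) z = 0 \<and> \<omega> (q l) z = 0" for i j k z
  proof -
    have "d\<omega> (p i) (q i) z + d\<omega> (p j) (q j) z = 0" "d\<omega> (p j) (q j) z + d\<omega> (p k) (q k) z = 0"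
      "d\<omega> (p i) (q i) z + d\<omega> (p k) (q k) z = 0"
      by (rule d\<omega>_two_pairs; use ijk z in \<open>simp add: h\<close>)+
    then have "2 * d\<omega> (p i) (q i) z = 0"
      by algebra
    then show ?thesis
      using two_neq_0 by simp
  qed
  have iso: "d\<omega> x y z = 0" if "\<omega> x y = 0" "\<omega> x z = 0" "\<omega> y z = 0"
    and "\<And>s. s \<in> {x, y, z} \<Longrightarrow> \<omega> s (p 3) = 0 \<and> \<omega> s (q 3) = 0" for x y z
    using that by (intro d\<omega>_isotropic[of x y z "p 3" "q 3"]) (auto simp: h)
  have cross: "bracket x (p 1) = 0" if x: "x \<in> {p 0, q 0}" for x
  proof -
    have "d\<omega> x (p 1) (p 2) = 0" "d\<omega> x (p 1) (q 2) = 0"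
      using x by (auto intro!: iso simp: h)
    moreover have "d\<omega> (p 2) (q 2) x = 0"
      using x by (intro pair[of 2 1 3]) (auto simp: h)
    moreover have "d\<omega> (p 2) (q 2) (p 1) = 0"
      by (intro pair[of 2 0 3]) (auto simp: h)
    ultimately show ?thesis
      using degree_4_identity[of x "p 1" "p 2" "q 2"] x
        d\<omega>_rotate[of x "p 2" "q 2"] d\<omega>_rotate[of "p 1" "p 2" "q 2"]
      by (auto simp: h)
  qed
  \<comment> \<open>Here \<open>3 - i - j\<close> is the index below 3 that differs from both \<open>i\<close> and \<open>j\<close>.\<close>
  have parallel: "bracket (p i) (q i) + bracket (p j) (q j) = 0"
    if "i < 3" "j < 3" "i \<noteq> j" for i j
  proof -
    have "3 - i - j < 4 \<and> 3 - i - j \<noteq> 3 \<and> 3 - i - j \<noteq> i \<and> 3 - i - j \<noteq> j"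
      using \<open>i < 3\<close> \<open>j < 3\<close> \<open>i \<noteq> j\<close> by presburger
    then obtain k where k: "k < 4" "k \<noteq> 3" "k \<noteq> i" "k \<noteq> j"
      by blast
    have "d\<omega> (p i) (q i) z = 0" if "z \<in> {p j, q j}" for z
      using that k \<open>i < 3\<close> \<open>j < 3\<close> \<open>i \<noteq> j\<close> by (intro pair[of i k 3]) (auto simp: h)
    moreover have "d\<omega> (p j) (q j) z = 0" if "z \<in> {p i, q i}" for z
      using that k \<open>i < 3\<close> \<open>j < 3\<close> \<open>i \<noteq> j\<close> by (intro pair[of j k 3]) (auto simp: h)
    ultimately show ?thesis
      using degree_4_identity[of "p i" "q i" "p j" "q j"] \<open>i < 3\<close> \<open>j < 3\<close> \<open>i \<noteq> j\<close>
        d\<omega>_rotate[of "p i" "p j" "q j"] d\<omega>_rotate[of "q i" "p j" "q j"]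
      by (simp add: h add.commute)
  qed
  \<comment> \<open>The brackets of any two of the first three pairs are opposite, so each equals its negative.\<close>
  have "bracket (p 0) (q 0) + bracket (p 0) (q 0) = 0"
    using parallel[of 0 1] parallel[of 0 2] parallel[of 1 2]
    by (simp add: eq_neg_iff_add_eq_0[symmetric])
  then have "bracket (p 0) (q 0) = 0"
    by (simp add: double_eq_0_iff)
  moreover have "bracket (p 1) (p 0) = 0" "bracket (q 0) (p 1) = 0"
    using cross[of "p 0"] cross[of "q 0"] anticommutative[of "p 1" "p 0"] by simp_all
  ultimately have "p 1 = 0"
    using omega_Jacobi[of "p 0" "q 0" "p 1"] bracket_scale_left[of 0 0] by (simp add: h)
  then show False
    using h(3)[of 1 1] by simp
qed

section \<open>Excluding the small dimensions\<close>

text \<open>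
  If \<open>g\<close> is such a form, applying it to the Jacobi identity gives \<open>d\<omega> = \<omega> \<and> g\<close>. Applying it to
  \<open>degree_4_identity\<close> turns the left-hand side into \<open>\<omega> \<and> \<omega>\<close>, which is 2 on two orthogonal
  hyperbolic pairs, and the right-hand side into \<open>\<omega> \<and> g \<and> g = 0\<close>.
\<close>

lemma no_primitive_of_form:
  assumes hyp: "hyperbolic_system p q 2"
    and g: "Vector_Spaces.linear scale (*) g"
    and primitive: "\<And>x y. g (bracket x y) = \<omega> x y"
  shows False
proof -
  interpret g: Vector_Spaces.linear scale "(*)" g by fact
  note h = hyperbolic_systemD[OF hyp]
  have d: "d\<omega> x y z = \<omega> x y * g z + \<omega> z x * g y + \<omega> y z * g x" for x y z
    using arg_cong[OF omega_Jacobi[of x y z], of g]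
    by (simp add: d\<omega>_def g.add g.scale primitive)
  have "(2::'k) = 0"
    using arg_cong[OF degree_4_identity[of "p 0" "q 0" "p 1" "q 1"], of g]
    by (simp add: g.add g.diff g.scale primitive d h)
  then show False
    using two_neq_0 by simp
qed

text \<open>
  Read as an equality of endomorphisms in \<open>z\<close>, the Jacobi identity says
  \<open>ad [x, y] = [ad x, ad y] + \<omega>(x, y) id\<close> plus two maps of rank at most one. The commutator has trace 0, and
  each of the two maps has trace \<open>\<omega>(y, x)\<close>.
\<close>

lemma trace_ad_bracket:
  assumes B: "finite_dimensional_vector_space scale B"
  defines "tr \<equiv> finite_dimensional_vector_space.trace scale B"
  shows "tr (bracket (bracket x y)) = (of_nat (card B) - 2) * \<omega> x y"
proof -
  interpret fd: finite_dimensional_vector_space scale B by fact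
  have "bracket (bracket x y) = (\<lambda>z. ((bracket x (bracket y z) - bracket y (bracket x z))
      + scale (\<omega> x y) z) + (scale (\<omega> z x) y + scale (\<omega> y z) x))"
  proof
    fix z
    show "bracket (bracket x y) z = ((bracket x (bracket y z) - bracket y (bracket x z))
      + scale (\<omega> x y) z) + (scale (\<omega> z x) y + scale (\<omega> y z) x)"
      using omega_Jacobi[of x y z] anticommutative[of z x]
        anticommutative[of "bracket x z" y] anticommutative[of "bracket y z" x]
      by (simp add: bracket_minus_left algebra_simps)
  qed
  then have "tr (bracket (bracket x y))
      = fd.trace (\<lambda>z. ((bracket x (bracket y z) - bracket y (bracket x z))
      + scale (\<omega> x y) z) + (scale (\<omega> z x) y + scale (\<omega> y z) x))"
    by (simp add: tr_def)
  also have "\<dots> = \<omega> x y * of_nat (card B) + (\<omega> y x + \<omega> y x)"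
    by (simp only: fd.trace_add fd.trace_diff fd.trace_scale fd.trace_id
      fd.trace_rank_one[OF linear_form_left] fd.trace_rank_one[OF linear_form_right]
      fd.trace_commute[OF linear_bracket_right linear_bracket_right, of x y] diff_self add_0)
  finally show ?thesis
    using form_skew[of y x] by (simp add: algebra_simps)
qed

text \<open>
  A single hyperbolic pair is linearly independent, which gives the lower bound. Since the number of pairs
  that exist grows with the dimension, the upper bound comes from the two exclusion results.
\<close>

lemma dim_eq_2:
  assumes fin: "finite_dimensional scale" and ne: "(UNIV :: 'v set) \<noteq> {0}"
  shows "dim (UNIV :: 'v set) = 2"
proof -
  obtain B where B: "independent B" "span B = UNIV" "card B = dim (UNIV :: 'v set)"
    using basis_exists[of UNIV] by (metis top.extremum_uniqueI)
  obtain S where S: "finite S" "span S = UNIV"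
    using fin by (auto simp: finite_dimensional_def)
  have "finite B"
    using independent_span_bound[OF S(1) B(1)] S(2) by simp
  with B have fdB: "finite_dimensional_vector_space scale B"
    by unfold_locales auto
  then interpret fd: finite_dimensional_vector_space scale B .
  let ?n = "dim (UNIV :: 'v set)"
  have "?n \<noteq> 0"
    using ne B \<open>finite B\<close> by auto
  then obtain p q where pq: "hyperbolic_system p q 1"
    using hyperbolic_system_exists[of 1] by auto
  have "\<omega> (p 0) (q 0) = 1"
    using hyperbolic_systemD(3)[OF pq, of 0 0] by simp
  have "\<omega> (p 0) w = 0" if "w \<in> span {p 0}" for w
    using that by (rule form_eq_0_on_span) (simp add: form_self)
  then have q: "q 0 \<notin> span {p 0}"
    using \<open>\<omega> (p 0) (q 0) = 1\<close> by force
  have "p 0 \<noteq> 0"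
    using \<open>\<omega> (p 0) (q 0) = 1\<close> by auto
  then have "independent {q 0, p 0}"
    using q by (simp add: independent_insert)
  moreover have "card {q 0, p 0} = 2"
    using q span_base[of "p 0" "{p 0}"] by (auto simp: card_insert_if)
  ultimately have "2 \<le> ?n"
    using fd.independent_card_le_dim[of "{q 0, p 0}" UNIV] by simp
  have "?n < 7"
    using hyperbolic_system_exists[of 4] no_four_hyperbolic_pairs by force
  have "\<not> 2 < ?n"
  proof
    assume "2 < ?n"
    then obtain p q where pq: "hyperbolic_system p q 2"
      using hyperbolic_system_exists[of 2] by auto
    let ?c = "of_nat ?n - 2 :: 'k"
    have "(4::'k) \<noteq> 0"
      using two_neq_0 mult_eq_0_iff[of "2::'k" 2] by simp
    moreover have "?n - 2 = 1 \<or> ?n - 2 = 2 \<or> ?n - 2 = 3 \<or> ?n - 2 = 4"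
      using \<open>2 < ?n\<close> \<open>?n < 7\<close> by linarith
    ultimately have "(of_nat (?n - 2) :: 'k) \<noteq> 0"
      using two_neq_0 three_neq_0 by (elim disjE) (simp_all only:, simp_all)
    then have c: "?c \<noteq> 0"
      using of_nat_diff[of 2 ?n, where 'a = 'k] \<open>2 < ?n\<close> by simp
    let ?g = "\<lambda>x. fd.trace (bracket x) / ?c"
    have "bracket (x + y) = (\<lambda>z. bracket x z + bracket y z)"
      "bracket (scale r x) = (\<lambda>z. scale r (bracket x z))" for x y r
      by (simp_all add: fun_eq_iff bracket_add_left bracket_scale_left)
    then have "Vector_Spaces.linear scale (*) ?g"
      \<comment> \<open>Only the vector space structures on both sides are taken from \<open>linear_form_right\<close>.\<close>
      using linear_form_right[of 0]
      by (simp add: Vector_Spaces.linear_iff fd.trace_add fd.trace_scale add_divide_distrib)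
    moreover have "?g (bracket x y) = \<omega> x y" for x y
      using trace_ad_bracket[OF fdB, of x y] c by (simp add: fd.dim_UNIV)
    ultimately show False
      by (rule no_primitive_of_form[OF pq])
  qed
  with \<open>2 \<le> ?n\<close> show ?thesis
    by simp
qed

end

theorem lemma8p1:
  fixes scale :: "'k::field \<Rightarrow> 'v::ab_group_add \<Rightarrow> 'v"
    and bracket :: "'v \<Rightarrow> 'v \<Rightarrow> 'v"
    and \<omega> :: "'v \<Rightarrow> 'v \<Rightarrow> 'k"
  assumes "CHAR('k) \<noteq> 2" and "CHAR('k) \<noteq> 3"
    and "omega_Lie_algebra scale bracket \<omega>"
    and "finite_dimensional scale"
    and "(UNIV :: 'v set) \<noteq> {0}"
    and "nondegenerate \<omega>"
  shows "vector_space.dim scale (UNIV :: 'v set) = 2"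
proof -
  have ne: "of_nat p \<noteq> (0::'k)" if "prime p" "CHAR('k) \<noteq> p" for p :: nat
    using that CHAR_not_1'[where 'a = 'k]
    by (auto simp: of_nat_eq_0_iff_char_dvd prime_nat_iff)
  have "prime (2::nat)" "prime (3::nat)"
    by simp_all
  then have char: "(2::'k) \<noteq> 0" "(3::'k) \<noteq> 0"
    using ne[of 2] ne[of 3] assms(1,2) by simp_all
  interpret omega_Lie_algebra scale bracket \<omega> by fact
  interpret nondegenerate_omega_Lie_algebra scale bracket \<omega>
    using char assms(6) by unfold_locales
  show ?thesis
    using assms(4,5) by (rule dim_eq_2)
qed

end
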